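(* Let $A$ and $B$ be nonempty finite subsets of an abelian group $G$, with $|A| = |B|$ and $1 \notin B$. Let $\rho$ be the right partition number of $(A,B)$. Then $B$ can be written as a union of right-admissible sets if and only if $\rho < \infty$. Moreover, when $\rho < \infty$, $B$ can be written as a union of $\rho$, and no fewer, pairwise disjoint right-admissible sets.
   Context: The group $G$ is written multiplicatively with identity $1$. For $S \subseteq G$ and $x\in G$, $Sx = \{sx : s \in S\}$. A partial matching of $(A,B)$ is an injective map $f : A' \to B$, where $A' \subseteq A$, such that $a f(a) \notin A$ for all $a \in A'$ (the empty map is allowed). A subset $B' \subseteq B$ is right-admissible if it is the range $f(A')$ of some partial matching $f : A' \to B$ of $(A,B)$; in particular the empty set is right-admissible. For $S \subseteq A$ let $U_S = \{b \in B : Sb \subseteq A\}$. The right partition number $\rho = \rho(A,B)$ is defined as follows: if $Ax \neq A$ for all $x \in B$, then $\rho$ is the maximum value of $\left\lceil \frac{|U_S|}{|A| - |S|} \right\rceil$, where $S$ ranges over all proper subsets of $A$ (including $\emptyset$); if $Ax = A$ for some $x \in B$, then $\rho = \infty$. *)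

theory Defs
  imports "HOL-Algebra.Coset" "HOL-Library.Extended_Nat" "HOL-Library.Disjoint_Sets" Complex_Main
begin

(* f : A' -> B is rendered by a total function of which only the values on A' matter *)
definition partial_matching ::
    "('a, 'm) monoid_scheme \<Rightarrow> 'a set \<Rightarrow> 'a set \<Rightarrow> 'a set \<Rightarrow> ('a \<Rightarrow> 'a) \<Rightarrow> bool"
  where "partial_matching G A B A' f \<longleftrightarrow>
    A' \<subseteq> A \<and> inj_on f A' \<and> f ` A' \<subseteq> B \<and> (\<forall>a\<in>A'. a \<otimes>\<^bsub>G\<^esub> f a \<notin> A)"

definition right_admissible ::
    "('a, 'm) monoid_scheme \<Rightarrow> 'a set \<Rightarrow> 'a set \<Rightarrow> 'a set \<Rightarrow> bool"
  where "right_admissible G A B B' \<longleftrightarrow> (\<exists>A' f. partial_matching G A B A' f \<and> B' = f ` A')"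

definition U_set ::
    "('a, 'm) monoid_scheme \<Rightarrow> 'a set \<Rightarrow> 'a set \<Rightarrow> 'a set \<Rightarrow> 'a set"
  where "U_set G A B S = {b \<in> B. S #>\<^bsub>G\<^esub> b \<subseteq> A}"

(* Only meaningful for finite A: then there are finitely many proper subsets S of A, at least
   one if A is nonempty, and the denominators are positive. *)
definition right_partition_number ::
    "('a, 'm) monoid_scheme \<Rightarrow> 'a set \<Rightarrow> 'a set \<Rightarrow> enat"
  where "right_partition_number G A B =
    (if \<exists>x\<in>B. A #>\<^bsub>G\<^esub> x = A then \<infinity>
     else enat (Max ((\<lambda>S. nat \<lceil>real (card (U_set G A B S)) / (real (card A) - real (card S))\<rceil>)
                      ` {S. S \<subset> A})))"

definition union_of_disjoint_right_admissible ::
    "('a, 'm) monoid_scheme \<Rightarrow> 'a set \<Rightarrow> 'a set \<Rightarrow> nat \<Rightarrow> bool"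
  where "union_of_disjoint_right_admissible G A B n \<longleftrightarrow>
    (\<exists>F :: nat \<Rightarrow> 'a set. (\<forall>i<n. right_admissible G A B (F i)) \<and>
       disjoint_family_on F {..<n} \<and> B = (\<Union>i<n. F i))"

end

theory Submission
  imports Defs
begin

text \<open>
  Join \<open>b \<in> B\<close> to \<open>a \<in> A\<close> whenever \<open>ab \<notin> A\<close>. A partition of \<open>B\<close> into \<open>n\<close> right-admissible sets is an
  injective choice, for each \<open>b\<close>, of a neighbour \<open>a\<close> together with a colour \<open>i < n\<close>, so Hall's marriage
  theorem decides its existence. Since \<open>U\<^sub>S\<close> is the largest set whose neighbours avoid \<open>S\<close>,
  Hall's condition reads \<open>|U\<^sub>S| \<le> n(|A| - |S|)\<close> for all \<open>S \<subseteq> A\<close>, which for \<open>S = A\<close> says that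
  \<open>Ax \<noteq> A\<close> on \<open>B\<close>, and for proper \<open>S\<close> says that \<open>n \<ge> \<rho>\<close>.
\<close>

text \<open>The proof is that of Halmos and Vaughan.\<close>

theorem Hall_marriage:
  fixes N :: "'i \<Rightarrow> 'b set"
  assumes "finite I" and "\<And>i. i \<in> I \<Longrightarrow> finite (N i)"
    and "\<And>J. J \<subseteq> I \<Longrightarrow> card J \<le> card (\<Union>(N ` J))"
  shows "\<exists>f. inj_on f I \<and> (\<forall>i\<in>I. f i \<in> N i)"
  using assms
proof (induction I arbitrary: N rule: finite_psubset_induct)
  case (psubset I)
  show ?case
  \<comment> \<open>Call \<open>J\<close> tight if it has exactly \<open>card J\<close> neighbours.
    A nonempty proper tight \<open>J\<close> is matched first, and the rest avoids its neighbours.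
    If there is none, every nonempty proper subset has a neighbour to spare, so one pair can be
    fixed arbitrarily.\<close>
  proof (cases "\<exists>J. J \<subset> I \<and> J \<noteq> {} \<and> card (\<Union>(N ` J)) = card J")
    case True
    then obtain J where J: "J \<subset> I" "J \<noteq> {}" "card (\<Union>(N ` J)) = card J" by blast
    obtain f where f: "inj_on f J" "\<forall>i\<in>J. f i \<in> N i"
      using psubset.IH[of J N] J psubset.prems by (metis psubsetE psubsetD subset_trans)
    let ?M = "\<lambda>i. N i - \<Union>(N ` J)"
    \<comment> \<open>Hall's condition survives the deletion: apply it to
      \<open>K \<union> J\<close> and subtract the neighbours of \<open>J\<close>, which number
      exactly \<open>card J\<close> by tightness.\<close>
    have "card K \<le> card (\<Union>(?M ` K))" if K: "K \<subseteq> I - J" for K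
    proof -
      have finK: "finite K" "finite J"
        using K J psubset.hyps by (auto intro: finite_subset)
      have "card K + card J = card (K \<union> J)"
        using K finK by (subst card_Un_disjoint) auto
      also have "\<dots> \<le> card (\<Union>(N ` (K \<union> J)))"
        using K J by (intro psubset.prems) auto
      also have "\<Union>(N ` (K \<union> J)) = \<Union>(?M ` K) \<union> \<Union>(N ` J)" by auto
      also have "card \<dots> \<le> card (\<Union>(?M ` K)) + card (\<Union>(N ` J))" by (rule card_Un_le)
      finally show ?thesis using J by simp
    qed
    moreover have "I - J \<subset> I" using J by auto
    moreover have "\<And>i. i \<in> I - J \<Longrightarrow> finite (?M i)" using psubset.prems by auto
    ultimately obtain g where g: "inj_on g (I - J)" "\<forall>i\<in>I - J. g i \<in> ?M i"
      using psubset.IH[of "I - J" ?M] by blast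
    let ?h = "\<lambda>i. if i \<in> J then f i else g i"
    have "f ` J \<subseteq> \<Union>(N ` J)" using f(2) by (intro image_subsetI UN_I) auto
    moreover have "g ` (I - J) \<inter> \<Union>(N ` J) = {}" using g(2) by (auto simp: disjoint_iff)
    ultimately have "f ` J \<inter> g ` (I - J) = {}" by auto
    then have "inj_on ?h (J \<union> (I - J))"
      using f(1) g(1) by (rule inj_on_disjoint_Un[rotated 2])
    moreover have "J \<union> (I - J) = I" using J by auto
    ultimately have "inj_on ?h I" by simp
    moreover have "\<forall>i\<in>I. ?h i \<in> N i" using f g by auto
    ultimately show ?thesis by blast
  next
    case strict: False
    show ?thesis
    proof (cases "I = {}")
      case True
      then show ?thesis by auto
    next
      case False
      then obtain i where i: "i \<in> I" by auto
      have "card {i} \<le> card (\<Union>(N ` {i}))" using i by (intro psubset.prems) auto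
      then obtain x where x: "x \<in> N i" by (cases "N i = {}") auto
      let ?M = "\<lambda>j. N j - {x}"
      \<comment> \<open>As \<open>K\<close> omits \<open>i\<close>, it is a proper subset of
        \<open>I\<close>. If nonempty, it is not tight, so losing the single value \<open>x\<close>
        still leaves at least \<open>card K\<close> neighbours.\<close>
      have "card K \<le> card (\<Union>(?M ` K))" if K: "K \<subseteq> I - {i}" for K
      proof (cases "K = {}")
        case False
        have "K \<subset> I" using K i by auto
        then have "card (\<Union>(N ` K)) \<noteq> card K" "card K \<le> card (\<Union>(N ` K))"
          using psubset.prems(2)[of K] strict False by auto
        then have "card K \<le> card (\<Union>(N ` K)) - 1" by linarith
        also have "\<dots> \<le> card (\<Union>(N ` K) - {x})"
          by (metis card_Diff_singleton_if diff_le_self order_refl)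
        also have "\<Union>(N ` K) - {x} = \<Union>(?M ` K)" by auto
        finally show ?thesis .
      qed simp
      moreover have "I - {i} \<subset> I" using i by auto
      moreover have "\<And>j. j \<in> I - {i} \<Longrightarrow> finite (?M j)" using psubset.prems by auto
      ultimately obtain g where g: "inj_on g (I - {i})" "\<forall>j\<in>I - {i}. g j \<in> ?M j"
        using psubset.IH[of "I - {i}" ?M] by blast
      have "x \<notin> g ` (I - {i})" using g(2) by auto
      moreover have "g(i := x) ` (I - {i}) = g ` (I - {i})" by auto
      ultimately have "inj_on (g(i := x)) (insert i (I - {i}))"
        using g(1) by (simp only: inj_on_insert) (auto intro: inj_on_fun_updI)
      moreover have "insert i (I - {i}) = I" using i by auto
      ultimately have "inj_on (g(i := x)) I" by simp
      moreover have "\<forall>j\<in>I. (g(i := x)) j \<in> N j" using g x by auto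
      ultimately show ?thesis by blast
    qed
  qed
qed

lemma mem_U_set: "b \<in> U_set G A B S \<longleftrightarrow> b \<in> B \<and> (\<forall>a\<in>S. a \<otimes>\<^bsub>G\<^esub> b \<in> A)"
  by (auto simp: U_set_def r_coset_def)

text \<open>A matching \<open>f\<close> sends no \<open>a \<in> S\<close> into
  \<open>U_set G A B S\<close>, because the product of \<open>a\<close> and \<open>f a\<close> lies
  outside \<open>A\<close>. So the elements of \<open>X\<close> in this set are all images of points
  of \<open>A - S\<close>.\<close>

lemma right_admissible_card_le:
  assumes "finite A" and "right_admissible G A B X"
  shows "card (U_set G A B S \<inter> X) \<le> card (A - S)"
proof -
  obtain A' f where f: "partial_matching G A B A' f" "X = f ` A'"
    using assms by (auto simp: right_admissible_def)
  then have "f a \<notin> U_set G A B S" if "a \<in> A'" "a \<in> S" for a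
    using that by (auto simp: partial_matching_def mem_U_set)
  with f have "U_set G A B S \<inter> X \<subseteq> f ` (A' - S)" by blast
  also have "\<dots> \<subseteq> f ` (A - S)"
    using f by (auto simp: partial_matching_def)
  finally show ?thesis
    using \<open>finite A\<close> by (meson card_image_le card_mono finite_Diff finite_imageI le_trans)
qed

text \<open>Necessity sums the preceding bound over the \<open>n\<close> sets. Sufficiency is Hall's
  theorem with each element of \<open>A\<close> available in \<open>n\<close> copies.\<close>

theorem union_of_disjoint_right_admissible_iff:
  assumes "finite A" and "finite B"
  shows "union_of_disjoint_right_admissible G A B n \<longleftrightarrow>
    (\<forall>S\<subseteq>A. card (U_set G A B S) \<le> n * (card A - card S))"
proof (intro iffI allI impI)
  fix S assume S: "S \<subseteq> A" and "union_of_disjoint_right_admissible G A B n"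
  then obtain F where F: "\<forall>i<n. right_admissible G A B (F i)" "B = (\<Union>i<n. F i)"
    by (auto simp: union_of_disjoint_right_admissible_def)
  have "U_set G A B S = (\<Union>i<n. U_set G A B S \<inter> F i)"
    using F by (auto simp: mem_U_set)
  then have "card (U_set G A B S) \<le> (\<Sum>i<n. card (U_set G A B S \<inter> F i))"
    by (metis card_UN_le finite_lessThan)
  also have "\<dots> \<le> (\<Sum>i<n. card (A - S))"
    using F \<open>finite A\<close> by (intro sum_mono right_admissible_card_le) auto
  also have "\<dots> = n * (card A - card S)"
    using S \<open>finite A\<close> by (simp add: card_Diff_subset finite_subset)
  finally show "card (U_set G A B S) \<le> n * (card A - card S)" .
next
  assume *: "\<forall>S\<subseteq>A. card (U_set G A B S) \<le> n * (card A - card S)"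
  \<comment> \<open>A pair \<open>(a, i)\<close> is a neighbour \<open>a\<close> of \<open>b\<close>
    with a colour \<open>i\<close>. An injective choice of pairs uses each \<open>a\<close> at most
    once per colour.\<close>
  define N where "N b = {a \<in> A. a \<otimes>\<^bsub>G\<^esub> b \<notin> A} \<times> {..<n}" for b
  have "card J \<le> card (\<Union>(N ` J))" if J: "J \<subseteq> B" for J
  proof -
    \<comment> \<open>The points of \<open>A\<close> joined to nothing in \<open>J\<close>. Thus
      \<open>A - S\<close> is exactly the neighbourhood of \<open>J\<close>, and the hypothesis for
      \<open>S\<close> bounds \<open>card J\<close>.\<close>
    define S where "S = {a \<in> A. \<forall>b\<in>J. a \<otimes>\<^bsub>G\<^esub> b \<in> A}"
    have "J \<subseteq> U_set G A B S" using J by (auto simp: mem_U_set S_def)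
    moreover have "finite (U_set G A B S)" using \<open>finite B\<close> by (simp add: U_set_def)
    ultimately have "card J \<le> card (U_set G A B S)" by (rule card_mono[rotated])
    also have "\<dots> \<le> n * (card A - card S)" using * by (auto simp: S_def)
    also have "\<dots> = card ((A - S) \<times> {..<n})"
      using \<open>finite A\<close> by (simp add: card_cartesian_product card_Diff_subset S_def)
    also have "(A - S) \<times> {..<n} = \<Union>(N ` J)" by (auto simp: N_def S_def)
    finally show ?thesis .
  qed
  then obtain h where h: "inj_on h B" "\<forall>b\<in>B. h b \<in> N b"
    using Hall_marriage[of B N] assms by (auto simp: N_def)
  \<comment> \<open>The colour classes. Within one class the second components of \<open>h\<close>
    agree, so \<open>fst \<circ> h\<close> is injective there. It runs from \<open>B\<close> to
    \<open>A\<close>, hence the partial matching is its inverse.\<close>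
  define F where "F i = {b \<in> B. snd (h b) = i}" for i
  have inj: "inj_on (fst \<circ> h) (F i)" for i
    using h(1) by (auto simp: inj_on_def F_def prod_eq_iff)
  have "partial_matching G A B ((fst \<circ> h) ` F i) (inv_into (F i) (fst \<circ> h))" for i
    unfolding partial_matching_def
  proof (intro conjI)
    show "(fst \<circ> h) ` F i \<subseteq> A"
      using h(2) by (auto simp: F_def N_def mem_Times_iff)
    show "inj_on (inv_into (F i) (fst \<circ> h)) ((fst \<circ> h) ` F i)"
      by (rule inj_on_inv_into) simp
    show "inv_into (F i) (fst \<circ> h) ` (fst \<circ> h) ` F i \<subseteq> B"
      using inj[of i] by (simp only: inv_into_image_cancel[OF _ subset_refl]) (simp add: F_def)
    show "\<forall>a\<in>(fst \<circ> h) ` F i. a \<otimes>\<^bsub>G\<^esub> inv_into (F i) (fst \<circ> h) a \<notin> A"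
    proof
      fix a assume "a \<in> (fst \<circ> h) ` F i"
      then obtain b where b: "b \<in> F i" "a = (fst \<circ> h) b" by blast
      then have "inv_into (F i) (fst \<circ> h) a = b" using inj by (simp only: inv_into_f_f)
      then show "a \<otimes>\<^bsub>G\<^esub> inv_into (F i) (fst \<circ> h) a \<notin> A"
        using b h(2) by (simp add: F_def N_def mem_Times_iff)
    qed
  qed
  moreover have "F i = inv_into (F i) (fst \<circ> h) ` (fst \<circ> h) ` F i" for i
    using inj[of i] by (simp only: inv_into_image_cancel[OF _ subset_refl])
  ultimately have "\<forall>i<n. right_admissible G A B (F i)"
    unfolding right_admissible_def by blast
  moreover have "disjoint_family_on F {..<n}"
    by (auto simp: disjoint_family_on_def F_def)
  moreover have "B = (\<Union>i<n. F i)"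
    using h(2) by (auto simp: F_def N_def mem_Times_iff)
  ultimately show "union_of_disjoint_right_admissible G A B n"
    unfolding union_of_disjoint_right_admissible_def by blast
qed

text \<open>A maximum is at most \<open>n\<close> iff all its terms are, and a ceiling is at most
  \<open>n\<close> iff the quotient is. The denominator is positive for proper \<open>S\<close>, so
  it can be cleared.\<close>

lemma right_partition_number_le_iff:
  assumes "finite A" and "A \<noteq> {}" and "\<not> (\<exists>x\<in>B. A #>\<^bsub>G\<^esub> x = A)"
  shows "right_partition_number G A B \<le> enat n \<longleftrightarrow>
    (\<forall>S\<subset>A. card (U_set G A B S) \<le> n * (card A - card S))"
proof -
  have "nat \<lceil>real (card (U_set G A B S)) / (real (card A) - real (card S))\<rceil> \<le> n \<longleftrightarrow>
      card (U_set G A B S) \<le> n * (card A - card S)" if "S \<subset> A" for S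
  proof -
    have less: "card S < card A" using that \<open>finite A\<close> by (rule psubset_card_mono[rotated])
    have "nat \<lceil>real (card (U_set G A B S)) / (real (card A) - real (card S))\<rceil> \<le> n \<longleftrightarrow>
        real (card (U_set G A B S)) / (real (card A) - real (card S)) \<le> real n"
      by (simp add: nat_le_iff ceiling_le_iff)
    also have "\<dots> \<longleftrightarrow> real (card (U_set G A B S)) \<le> real (n * (card A - card S))"
      using less by (simp add: divide_le_eq of_nat_diff)
    finally show ?thesis by (simp only: of_nat_le_iff)
  qed
  moreover have "finite {S. S \<subset> A}"
    by (rule finite_subset[of _ "Pow A"]) (use \<open>finite A\<close> in auto)
  moreover have "{S. S \<subset> A} \<noteq> {}"
    using \<open>A \<noteq> {}\<close> by auto
  ultimately show ?thesis
    using assms(3) by (auto simp: right_partition_number_def)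
qed

text \<open>Right translation is injective, and an injective self-map of a finite set is onto. This
  ties the case \<open>A #> x = A\<close> of the partition number to
  \<open>U_set G A B A\<close>.\<close>

lemma (in group) r_coset_eq_iff_subset:
  assumes "A \<subseteq> carrier G" and "finite A" and "x \<in> carrier G"
  shows "A #> x = A \<longleftrightarrow> A #> x \<subseteq> A"
proof -
  have "A #> x = (\<lambda>a. a \<otimes> x) ` A" by (auto simp: r_coset_def)
  moreover have "inj_on (\<lambda>a. a \<otimes> x) A"
  proof (rule inj_onI)
    fix a b assume "a \<in> A" "b \<in> A" "a \<otimes> x = b \<otimes> x"
    with assms show "a = b" by (metis right_cancel subsetD)
  qed
  ultimately show ?thesis using endo_inj_surj[OF \<open>finite A\<close>] by auto
qed

text \<open>Lying in some right-admissible set forces \<open>b\<close> to have a neighbour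
  \<open>a\<close>; conversely, sending \<open>a\<close> to \<open>b\<close> makes the singleton
  \<open>{b}\<close> right-admissible.\<close>

lemma Union_right_admissible_iff:
  "(\<exists>\<F>. (\<forall>X\<in>\<F>. right_admissible G A B X) \<and> B = \<Union>\<F>) \<longleftrightarrow> (\<forall>b\<in>B. \<exists>a\<in>A. a \<otimes>\<^bsub>G\<^esub> b \<notin> A)"
proof
  assume "\<exists>\<F>. (\<forall>X\<in>\<F>. right_admissible G A B X) \<and> B = \<Union>\<F>"
  then obtain \<F> where \<F>: "\<forall>X\<in>\<F>. right_admissible G A B X" "B = \<Union>\<F>" by blast
  show "\<forall>b\<in>B. \<exists>a\<in>A. a \<otimes>\<^bsub>G\<^esub> b \<notin> A"
  proof
    fix b assume "b \<in> B"
    with \<F> obtain X where "b \<in> X" "right_admissible G A B X" by blast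
    then show "\<exists>a\<in>A. a \<otimes>\<^bsub>G\<^esub> b \<notin> A"
      by (auto simp: right_admissible_def partial_matching_def)
  qed
next
  assume *: "\<forall>b\<in>B. \<exists>a\<in>A. a \<otimes>\<^bsub>G\<^esub> b \<notin> A"
  have "right_admissible G A B {b}" if b: "b \<in> B" for b
  proof -
    obtain a where "a \<in> A" "a \<otimes>\<^bsub>G\<^esub> b \<notin> A" using * b by blast
    with b have "partial_matching G A B {a} (\<lambda>_. b)" by (simp add: partial_matching_def)
    then show ?thesis unfolding right_admissible_def by (intro exI[of _ "{a}"] exI[of _ "\<lambda>_. b"]) simp
  qed
  then show "\<exists>\<F>. (\<forall>X\<in>\<F>. right_admissible G A B X) \<and> B = \<Union>\<F>"
    by (intro exI[of _ "(\<lambda>b. {b}) ` B"]) auto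
qed

theorem theorem5p1:
  fixes G :: "('a, 'm) monoid_scheme" and A B :: "'a set"
  assumes "comm_group G"
    and "A \<subseteq> carrier G" and "B \<subseteq> carrier G"
    and "finite A" and "finite B"
    and "A \<noteq> {}" and "B \<noteq> {}"
    and "card A = card B"
    and "\<one>\<^bsub>G\<^esub> \<notin> B"
  shows "((\<exists>\<F>. (\<forall>X\<in>\<F>. right_admissible G A B X) \<and> B = \<Union>\<F>)
            \<longleftrightarrow> right_partition_number G A B < \<infinity>)
    \<and> (\<forall>n. right_partition_number G A B = enat n \<longrightarrow>
          union_of_disjoint_right_admissible G A B n
          \<and> (\<forall>k<n. \<not> union_of_disjoint_right_admissible G A B k))"
proof -
  interpret comm_group G by fact
  have stab: "A #>\<^bsub>G\<^esub> x = A \<longleftrightarrow> (\<forall>a\<in>A. a \<otimes>\<^bsub>G\<^esub> x \<in> A)" if "x \<in> B" for x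
  proof -
    have "x \<in> carrier G" using assms that by auto
    then have "A #>\<^bsub>G\<^esub> x = A \<longleftrightarrow> A #>\<^bsub>G\<^esub> x \<subseteq> A"
      using assms by (intro r_coset_eq_iff_subset)
    then show ?thesis by (simp add: r_coset_def UN_subset_iff)
  qed
  have infty: "right_partition_number G A B < \<infinity> \<longleftrightarrow> \<not> (\<exists>x\<in>B. A #>\<^bsub>G\<^esub> x = A)"
    by (simp add: right_partition_number_def)
  \<comment> \<open>Having this for every \<open>k\<close> gives both claims about a finite
    partition number: that many sets suffice, and fewer do not.\<close>
  have "union_of_disjoint_right_admissible G A B k \<longleftrightarrow> right_partition_number G A B \<le> enat k"
    if "right_partition_number G A B < \<infinity>" for k
  proof -
    have no_stab: "\<not> (\<exists>x\<in>B. A #>\<^bsub>G\<^esub> x = A)" using that infty by blast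
    \<comment> \<open>For \<open>S = A\<close> the bound is \<open>0\<close>, and it holds because
      no element of \<open>B\<close> stabilises \<open>A\<close>. Only the proper subsets still
      impose a condition.\<close>
    then have "U_set G A B A = {}" using stab by (simp add: set_eq_iff[of "U_set G A B A"] mem_U_set)
    then have "(\<forall>S\<subseteq>A. card (U_set G A B S) \<le> k * (card A - card S)) \<longleftrightarrow>
        (\<forall>S\<subset>A. card (U_set G A B S) \<le> k * (card A - card S))"
      by (auto simp: subset_iff_psubset_eq)
    then show ?thesis
      using right_partition_number_le_iff[OF \<open>finite A\<close> \<open>A \<noteq> {}\<close> no_stab]
      by (simp add: union_of_disjoint_right_admissible_iff \<open>finite A\<close> \<open>finite B\<close>)
  qed
  moreover have "(\<forall>x\<in>B. \<exists>a\<in>A. a \<otimes>\<^bsub>G\<^esub> x \<notin> A) \<longleftrightarrow> right_partition_number G A B < \<infinity>"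
    using infty stab by blast
  ultimately show ?thesis
    by (simp add: Union_right_admissible_iff)
qed

end
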